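(* Suppose $P$ is a finite lattice. Then $\chi\colon \mathrm{Fac}(P)\to \mathrm{End}(P)$, $(L,R)\mapsto\chi^{(L,R)}$, has image $\mathrm{End}^\circ(P)$. The fibers of $\chi$ are intervals in $\mathrm{Fac}(P)$, and restricting $\chi$ to maximal elements of fibers produces a bijection between coreflective factorization systems and interior operators. Dually, $\lambda\colon \mathrm{Fac}(P)\to \mathrm{End}(P)$, $(L,R)\mapsto\lambda^{(L,R)}$, has image $\overline{\mathrm{End}}(P)$. The fibers of $\lambda$ are intervals in $\mathrm{Fac}(P)$, and restricting $\lambda$ to minimal elements of fibers produces a bijection between reflective factorization systems and closure operators.
   Context: A finite lattice $P$ with minimum $0$ and maximum $1$ is viewed as a category with a unique morphism $x\to y$ exactly when $x\le y$; classes of morphisms are subsets of the relation $\le$, and we write $x\,M\,y$ when the relation $x\le y$ belongs to $M$. A relation $a\le b$ has the left lifting property with respect to $x\le y$ (and $x\le y$ has the right lifting property with respect to $a\le b$) if $a\le x$ and $b\le y$ together imply $b\le x$. For a class $M$, ${}^\perp M$ is the class of relations with the left lifting property with respect to all of $M$, and $M^\perp$ is the class of relations with the right lifting property with respect to all of $M$. A factorization system on $P$ is a pair $(L,R)$ of classes of relations such that every relation $x\le z$ factors as $x\,L\,y\,R\,z$ for some $y$, and $L={}^\perp R$, $R=L^\perp$. The factoring object $y$ is then unique. $\mathrm{Fac}(P)$ is the set of factorization systems on $P$, ordered by $(L,R)\le (L',R')$ iff $R\subseteq R'$ (equivalently $L'\subseteq L$). $\mathrm{End}(P)$ is the poset of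 monotone maps $P\to P$ with the pointwise order. The characteristic function $\chi^{(L,R)}\in\mathrm{End}(P)$ sends $x$ to the unique object with $0\,L\,\chi^{(L,R)}(x)\,R\,x$; the cocharacteristic function $\lambda^{(L,R)}\in\mathrm{End}(P)$ sends $x$ to the unique object with $x\,L\,\lambda^{(L,R)}(x)\,R\,1$. A closure operator on $P$ is a monotone $c\colon P\to P$ with $x\le c(x)$ and $c(c(x))=c(x)$ for all $x$; $\overline{\mathrm{End}}(P)$ is the poset of closure operators under the pointwise order. An interior operator on $P$ is a monotone $i\colon P\to P$ with $i(x)\le x$ and $i(i(x))=i(x)$ for all $x$; $\mathrm{End}^\circ(P)$ is the poset of interior operators under the pointwise order. An interval in a poset $Q$ is an induced subposet of the form $[a,b]=\{x\in Q\mid a\le x\le b\}$. A factorization system $(L,R)$ on $P$ is reflective if $R/1$, the subcategory of $P$ with objects $\{x\in P\mid x\,R\,1\}$, is a reflective subcategory of $P$, that is, the inclusion functor $R/1\to P$ admits a left adjoint (for a lattice, equivalently, $\{x\in P\mid x\,R\,1\}$ is closed under meet in $P$). Dually, $(L,R)$ is coreflective if $0\backslash L$, the subcategory of $P$ with objects $\{x\in P\mid 0\,L\,x\}$, is a coreflective subcategory of $P$, that is, the inclusion functor $0\backslash L\to P$ admits a right adjoint (for a lattice, equivalently, $\{x\in P\mid 0\,L\,x\}$ is closed under join in $P$).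
   Formalization: As defined, every factorization system is reflective and coreflective, so the bijections fail (3-chain: 5 systems, 4 operators). Proved instead: maximal (minimal) fiber elements are coreflective (reflective), and these alone biject with interior (closure) operators. *)

theory Defs
  imports Main
begin

text \<open>A finite lattice is a type of class \<open>{finite, bounded_lattice}\<close>, with \<open>bot\<close> and \<open>top\<close> for
  0 and 1. A class of morphisms is a set of pairs \<open>(x, y)\<close> with \<open>x \<le> y\<close>; \<open>x M y\<close> is
  \<open>(x, y) \<in> M\<close>.\<close>

definition lifts :: "'a::order \<times> 'a \<Rightarrow> 'a \<times> 'a \<Rightarrow> bool" where
  "lifts = (\<lambda>(a, b) (x, y). a \<le> x \<and> b \<le> y \<longrightarrow> b \<le> x)"

definition left_perp :: "'a::order rel \<Rightarrow> 'a rel" where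
  "left_perp M = {(a, b). a \<le> b \<and> (\<forall>m\<in>M. lifts (a, b) m)}"

definition right_perp :: "'a::order rel \<Rightarrow> 'a rel" where
  "right_perp M = {(x, y). x \<le> y \<and> (\<forall>m\<in>M. lifts m (x, y))}"

text \<open>\<open>L\<close> and \<open>R\<close> are contained in \<open>\<le>\<close> because \<open>left_perp\<close> and \<open>right_perp\<close> are.\<close>

definition Fac :: "('a::order rel \<times> 'a rel) set" where
  "Fac = {(L, R). (\<forall>x z. x \<le> z \<longrightarrow> (\<exists>y. (x, y) \<in> L \<and> (y, z) \<in> R)) \<and>
                  L = left_perp R \<and> R = right_perp L}"

text \<open>This is the order on \<open>Fac\<close>, as opposed to the componentwise order on pairs of sets.\<close>

definition fac_le :: "'a rel \<times> 'a rel \<Rightarrow> 'a rel \<times> 'a rel \<Rightarrow> bool" where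
  "fac_le F G \<longleftrightarrow> snd F \<subseteq> snd G"

definition char_fun :: "'a::{order, order_bot} rel \<times> 'a rel \<Rightarrow> 'a \<Rightarrow> 'a" where
  "char_fun = (\<lambda>(L, R) x. THE y. (bot, y) \<in> L \<and> (y, x) \<in> R)"

definition cochar_fun :: "'a::{order, order_top} rel \<times> 'a rel \<Rightarrow> 'a \<Rightarrow> 'a" where
  "cochar_fun = (\<lambda>(L, R) x. THE y. (x, y) \<in> L \<and> (y, top) \<in> R)"

definition closure_operators :: "('a::order \<Rightarrow> 'a) set" where
  "closure_operators = {c. mono c \<and> (\<forall>x. x \<le> c x) \<and> (\<forall>x. c (c x) = c x)}"

definition interior_operators :: "('a::order \<Rightarrow> 'a) set" where
  "interior_operators = {i. mono i \<and> (\<forall>x. i x \<le> x) \<and> (\<forall>x. i (i x) = i x)}"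

definition fiber :: "('a::order rel \<times> 'a rel \<Rightarrow> 'a \<Rightarrow> 'a) \<Rightarrow> ('a \<Rightarrow> 'a) \<Rightarrow> ('a rel \<times> 'a rel) set" where
  "fiber \<phi> f = {F \<in> Fac. \<phi> F = f}"

definition is_fac_interval :: "('a::order rel \<times> 'a rel) set \<Rightarrow> bool" where
  "is_fac_interval S \<longleftrightarrow>
     (\<exists>A\<in>Fac. \<exists>B\<in>Fac. S = {F \<in> Fac. fac_le A F \<and> fac_le F B})"

definition maximal_elements :: "('a rel \<times> 'a rel) set \<Rightarrow> ('a rel \<times> 'a rel) set" where
  "maximal_elements S = {F \<in> S. \<forall>G\<in>S. fac_le F G \<longrightarrow> G = F}"

definition minimal_elements :: "('a rel \<times> 'a rel) set \<Rightarrow> ('a rel \<times> 'a rel) set" where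
  "minimal_elements S = {F \<in> S. \<forall>G\<in>S. fac_le G F \<longrightarrow> G = F}"

text \<open>Functors between posets are monotone maps. The adjunction of \<open>r\<close> with the inclusion of the
  full subposet on \<open>S\<close> is the displayed equivalence.\<close>

definition reflective_subset :: "'a::order set \<Rightarrow> bool" where
  "reflective_subset S \<longleftrightarrow>
     (\<exists>r. mono r \<and> range r \<subseteq> S \<and> (\<forall>x. \<forall>s\<in>S. r x \<le> s \<longleftrightarrow> x \<le> s))"

definition coreflective_subset :: "'a::order set \<Rightarrow> bool" where
  "coreflective_subset S \<longleftrightarrow>
     (\<exists>r. mono r \<and> range r \<subseteq> S \<and> (\<forall>x. \<forall>s\<in>S. s \<le> r x \<longleftrightarrow> s \<le> x))"

text \<open>On a finite lattice every factorization system is reflective and coreflective in this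
  sense: \<open>{x. (x, top) \<in> R}\<close> is closed under meets because \<open>R\<close> is a right orthogonal class, and
  dually. So these notions do not by themselves single out one element of each fiber.\<close>

definition reflective :: "'a::{order, order_top} rel \<times> 'a rel \<Rightarrow> bool" where
  "reflective F \<longleftrightarrow> F \<in> Fac \<and> reflective_subset {x. (x, top) \<in> snd F}"

definition coreflective :: "'a::{order, order_bot} rel \<times> 'a rel \<Rightarrow> bool" where
  "coreflective F \<longleftrightarrow> F \<in> Fac \<and> coreflective_subset {x. (bot, x) \<in> fst F}"

end

theory Submission
  imports Defs "HOL-Library.Dual_Ordered_Lattice"
begin

text \<open>
  The right classes of factorization systems on a finite lattice are exactly the \<^emph>\<open>transfer
  systems\<close>: partial orders refining \<open>\<le>\<close> that are stable under pullback, i.e. \<open>x R z\<close> and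
  \<open>w \<le> z\<close> imply \<open>(x \<sqinter> w) R w\<close> (lemma \<open>Fac_iff_transfer\<close>). Finiteness enters
  here: the middle object of a factorization of \<open>x \<le> z\<close> is a minimal \<open>y \<ge> x\<close> with \<open>y R z\<close>.
  So everything about \<open>(L, R)\<close> can be read off \<open>R\<close>, and \<open>\<chi>(x)\<close> is the least \<open>y\<close> with \<open>y R x\<close>
  (\<open>char_fun_eq_iff\<close>).

  From this description, \<open>\<chi>\<close> is an interior operator: monotonicity is stability under pullback
  and idempotence is transitivity of \<open>R\<close>. It is also antitone in \<open>R\<close>, so each fiber is convex.
  For an interior operator \<open>i\<close>, every \<open>R\<close> with \<open>\<chi> = i\<close> is contained in
  \<open>{(x, y). x \<le> y \<and> i y \<le> x}\<close>, because \<open>\<chi>(y)\<close> lies below every \<open>x\<close> with \<open>x R y\<close>. This relation is itself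
  a transfer system with characteristic function \<open>i\<close>; hence \<open>i\<close> is in the image and its fiber has a
  greatest element. A least element is obtained by intersecting all the right classes in the
  fiber: transfer systems are closed under intersection, and the least \<open>y\<close> with \<open>y R x\<close> is the same
  \<open>i x\<close> for all of them. A convex set with a least and a greatest element is an interval
  (\<open>fiber_char_fun_interval\<close>), and its unique maximal element is the greatest one, so
  restricting \<open>\<chi>\<close> to maximal elements of fibers is a bijection onto the interior operators.
  Coreflectivity is automatic: \<open>\<chi>\<close> itself is right adjoint to the inclusion of
  \<open>{x. (0, x) \<in> L}\<close>, by the lifting property of \<open>0 \<le> s\<close> against \<open>\<chi>(x) \<le> x\<close>.

  The statements on \<open>\<lambda>\<close> are those on \<open>\<chi>\<close> for the dual lattice: reversing all morphisms
  exchanges \<open>L\<close> and \<open>R\<close> and turns \<open>\<lambda>\<close> into \<open>\<chi>\<close>. As \<open>R \<subseteq> R'\<close> is equivalent to \<open>L' \<subseteq> L\<close>, it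
  also reverses the order on factorization systems, whence minimal in place of maximal elements.
\<close>

section \<open>Factorization systems as transfer systems\<close>

definition transfer_system :: "'a::{order, inf} rel \<Rightarrow> bool" where
  "transfer_system R \<longleftrightarrow>
     (\<forall>x y. (x, y) \<in> R \<longrightarrow> x \<le> y) \<and> refl R \<and> trans R \<and>
     (\<forall>x z w. (x, z) \<in> R \<longrightarrow> w \<le> z \<longrightarrow> (inf x w, w) \<in> R)"

lemma transfer_systemD:
  assumes "transfer_system R"
  shows "(x, y) \<in> R \<Longrightarrow> x \<le> y"
    and "(x, x) \<in> R"
    and "(x, y) \<in> R \<Longrightarrow> (y, z) \<in> R \<Longrightarrow> (x, z) \<in> R"
    and "(x, z) \<in> R \<Longrightarrow> w \<le> z \<Longrightarrow> (inf x w, w) \<in> R"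
  using assms by (auto simp: transfer_system_def dest: reflD transD)

lemma left_perp_iff:
  "(a, b) \<in> left_perp M \<longleftrightarrow>
     a \<le> b \<and> (\<forall>x y. (x, y) \<in> M \<longrightarrow> a \<le> x \<longrightarrow> b \<le> y \<longrightarrow> b \<le> x)"
  by (auto simp: left_perp_def lifts_def)

lemma right_perp_iff:
  "(x, y) \<in> right_perp M \<longleftrightarrow>
     x \<le> y \<and> (\<forall>a b. (a, b) \<in> M \<longrightarrow> a \<le> x \<longrightarrow> b \<le> y \<longrightarrow> b \<le> x)"
  by (auto simp: right_perp_def lifts_def)

lemma transfer_system_right_perp:
  "transfer_system (right_perp M)" for M :: "'a::lattice rel"
  unfolding transfer_system_def
proof (intro conjI allI impI)
  show "refl (right_perp M)"
    by (auto simp: refl_on_def right_perp_iff)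
  show "trans (right_perp M)"
    unfolding trans_def right_perp_iff by (meson order_trans)
next
  fix x z w
  assume "(x, z) \<in> right_perp M" "w \<le> z"
  then show "(inf x w, w) \<in> right_perp M"
    unfolding right_perp_iff by (meson inf.boundedE inf.boundedI inf_le2 order_trans)
qed (auto simp: right_perp_iff)

lemma transfer_system_factorization:
  fixes R :: "'a::{finite, lattice} rel"
  assumes R: "transfer_system R" and "x \<le> z"
  shows "\<exists>y. (x, y) \<in> left_perp R \<and> (y, z) \<in> R"
proof -
  let ?Y = "{y. x \<le> y \<and> (y, z) \<in> R}"
  have "z \<in> ?Y"
    using \<open>x \<le> z\<close> transfer_systemD(2)[OF R] by simp
  then obtain y where y: "y \<in> ?Y" and minimal: "\<And>y'. y' \<in> ?Y \<Longrightarrow> y' \<le> y \<Longrightarrow> y' = y"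
    using finite_has_minimal[of ?Y] by auto
  have "y \<le> a" if "(a, b) \<in> R" "x \<le> a" "y \<le> b" for a b
  proof -
    \<comment> \<open>Pulling \<open>a R b\<close> back along \<open>y \<le> b\<close> yields a competitor of \<open>y\<close>.\<close>
    have "inf a y \<in> ?Y"
      using transfer_systemD(3,4)[OF R] that y by fastforce
    then show ?thesis
      using minimal by (metis inf.cobounded1 inf_le2)
  qed
  with y show ?thesis
    by (auto simp: left_perp_iff)
qed

text \<open>The nontrivial inclusion in \<open>R = right_perp (left_perp R)\<close> is a retract argument: if the right
  perpendicular \<open>x \<le> z\<close> factors as \<open>x L y R z\<close>, then lifting \<open>x \<le> y\<close> against it gives \<open>y \<le> x\<close>.\<close>

lemma transfer_system_Fac:
  fixes R :: "'a::{finite, lattice} rel"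
  assumes R: "transfer_system R"
  shows "(left_perp R, R) \<in> Fac"
proof -
  have "(x, z) \<in> R" if xz: "(x, z) \<in> right_perp (left_perp R)" for x z
  proof -
    obtain y where y: "(x, y) \<in> left_perp R" "(y, z) \<in> R"
      using transfer_system_factorization[OF R] xz unfolding right_perp_iff by blast
    then have "y \<le> x"
      using xz transfer_systemD(1)[OF R] by (auto simp: right_perp_iff)
    moreover have "x \<le> y"
      using y(1) by (simp add: left_perp_iff)
    ultimately show ?thesis
      using y(2) by simp
  qed
  moreover have "R \<subseteq> right_perp (left_perp R)"
    using transfer_systemD(1)[OF R] by (auto simp: right_perp_iff left_perp_iff)
  ultimately show ?thesis
    using transfer_system_factorization[OF R] by (auto simp: Fac_def)
qed

text \<open>Right perpendiculars are always transfer systems, so this makes \<open>F \<mapsto> snd F\<close> a bijection from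
  \<open>Fac\<close> to transfer systems; intersections and explicit relations can then be handled without
  mentioning left classes.\<close>

theorem Fac_iff_transfer:
  "F \<in> Fac \<longleftrightarrow> transfer_system (snd F) \<and> fst F = left_perp (snd F)"
  for F :: "'a::{finite, lattice} rel \<times> 'a rel"
proof
  assume "F \<in> Fac"
  then have "snd F = right_perp (fst F)" and "fst F = left_perp (snd F)"
    by (auto simp: Fac_def)
  then show "transfer_system (snd F) \<and> fst F = left_perp (snd F)"
    using transfer_system_right_perp by metis
next
  assume "transfer_system (snd F) \<and> fst F = left_perp (snd F)"
  then show "F \<in> Fac"
    by (metis transfer_system_Fac prod.collapse)
qed

lemma fac_le_antisym:
  "F \<in> Fac \<Longrightarrow> G \<in> Fac \<Longrightarrow> fac_le F G \<Longrightarrow> fac_le G F \<Longrightarrow> F = G"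
  by (auto simp: Fac_def fac_le_def)

section \<open>The characteristic function\<close>

text \<open>Uniqueness of \<open>y\<close> in \<open>0 L y R x\<close>, which gives the definite description its meaning: lifting
  \<open>0 \<le> y'\<close> against \<open>y'' \<le> x\<close> yields \<open>y' \<le> y''\<close>, and the situation is symmetric.\<close>

lemma char_fun_factors:
  fixes F :: "'a::{order, order_bot} rel \<times> 'a rel"
  assumes F: "F \<in> Fac"
  shows "(bot, char_fun F x) \<in> fst F \<and> (char_fun F x, x) \<in> snd F"
proof -
  obtain y where "(bot, y) \<in> fst F" "(y, x) \<in> snd F"
    using F bot_least[of x] unfolding Fac_def by fastforce
  moreover have "y' \<le> y''"
    if "(bot, y') \<in> fst F" "(y', x) \<in> snd F" "(y'', x) \<in> snd F" for y' y''
  proof -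
    have "(bot, y') \<in> left_perp (snd F)" "(y', x) \<in> right_perp (fst F)"
      using that(1,2) F by (auto simp: Fac_def)
    then show ?thesis
      using that(3) unfolding left_perp_iff right_perp_iff by (meson bot_least)
  qed
  ultimately have "\<exists>!y. (bot, y) \<in> fst F \<and> (y, x) \<in> snd F"
    by (blast intro: order_antisym)
  then show ?thesis
    unfolding char_fun_def case_prod_unfold by (rule theI')
qed

lemma char_fun_least:
  assumes "F \<in> Fac" "(y, x) \<in> snd F"
  shows "char_fun F x \<le> y"
proof -
  have "(bot, char_fun F x) \<in> left_perp (snd F)" "(char_fun F x, x) \<in> right_perp (fst F)"
    using char_fun_factors[OF assms(1)] assms(1) by (auto simp: Fac_def)
  then show ?thesis
    using assms(2) by (auto simp: left_perp_iff right_perp_iff)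
qed

lemma char_fun_eq_iff:
  assumes "F \<in> Fac"
  shows "char_fun F x = y \<longleftrightarrow> (y, x) \<in> snd F \<and> (\<forall>w. (w, x) \<in> snd F \<longrightarrow> y \<le> w)"
  using char_fun_factors[OF assms] char_fun_least[OF assms] by (metis order_antisym)

lemma char_fun_antitone:
  "F \<in> Fac \<Longrightarrow> G \<in> Fac \<Longrightarrow> fac_le F G \<Longrightarrow> char_fun G x \<le> char_fun F x"
  using char_fun_least[of G "char_fun F x" x] char_fun_factors[of F x] by (auto simp: fac_le_def)

lemma char_fun_interior:
  fixes F :: "'a::{finite, bounded_lattice} rel \<times> 'a rel"
  assumes "F \<in> Fac"
  shows "char_fun F \<in> interior_operators"
proof -
  have R: "transfer_system (snd F)"
    using assms Fac_iff_transfer by blast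
  have factors: "(char_fun F x, x) \<in> snd F" for x
    using char_fun_factors[OF assms] by blast
  have below: "char_fun F x \<le> x" for x
    using transfer_systemD(1)[OF R factors] .
  have "char_fun F x \<le> char_fun F y" if "x \<le> y" for x y
    using char_fun_least[OF assms transfer_systemD(4)[OF R factors that]] by simp
  moreover have "char_fun F (char_fun F x) = char_fun F x" for x
    using char_fun_least[OF assms transfer_systemD(3)[OF R factors factors]] below
    by (auto intro: order_antisym)
  ultimately show ?thesis
    using below by (auto simp: interior_operators_def mono_def)
qed

text \<open>The coreflector is \<open>\<chi>\<close>: if \<open>0 L s\<close> and \<open>s \<le> x\<close>, lifting \<open>0 \<le> s\<close> against \<open>\<chi>(x) \<le> x\<close> gives
  \<open>s \<le> \<chi>(x)\<close>.\<close>

lemma Fac_coreflective: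
  fixes F :: "'a::{finite, bounded_lattice} rel \<times> 'a rel"
  assumes F: "F \<in> Fac"
  shows "coreflective F"
proof -
  have "mono (char_fun F)" and below: "char_fun F x \<le> x" for x
    using char_fun_interior[OF F] by (auto simp: interior_operators_def)
  moreover have "s \<le> char_fun F x" if "(bot, s) \<in> fst F" "s \<le> x" for s x
    using char_fun_factors[OF F, of x] F that by (auto simp: Fac_def left_perp_iff)
  ultimately show ?thesis
    unfolding coreflective_def coreflective_subset_def
    using F char_fun_factors[OF F]
    by (intro conjI exI[of _ "char_fun F"]) (auto intro: order_trans)
qed

section \<open>Fibers of the characteristic function\<close>

text \<open>The right class of the greatest element of the fiber over \<open>i\<close>. For an interior operator the
  condition says that \<open>i x = i y\<close>.\<close>

definition interior_rel :: "('a::order \<Rightarrow> 'a) \<Rightarrow> 'a rel" where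
  "interior_rel i = {(x, y). x \<le> y \<and> i y \<le> x}"

lemma transfer_system_interior_rel:
  fixes i :: "'a::lattice \<Rightarrow> 'a"
  assumes i: "i \<in> interior_operators"
  shows "transfer_system (interior_rel i)"
proof -
  have mono: "x \<le> y \<Longrightarrow> i x \<le> i y" and below: "i x \<le> x" and idem: "i (i x) = i x" for x y
    using i by (auto simp: interior_operators_def mono_def)
  have "i z \<le> x" if "i y \<le> x" "i z \<le> y" for x y z
    using mono[OF that(2)] that(1) idem by (metis order_trans)
  then have "trans (interior_rel i)"
    unfolding interior_rel_def by (intro transI) (auto intro: order_trans)
  moreover have "i w \<le> x" if "i z \<le> x" "w \<le> z" for w x z
    using mono[OF that(2)] that(1) by (rule order_trans)
  ultimately show ?thesis
    using below by (auto simp: transfer_system_def interior_rel_def refl_on_def)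
qed

lemma char_fun_interior_rel:
  fixes i :: "'a::{finite, bounded_lattice} \<Rightarrow> 'a"
  assumes i: "i \<in> interior_operators"
  shows "char_fun (left_perp (interior_rel i), interior_rel i) = i"
  using transfer_system_Fac[OF transfer_system_interior_rel[OF i]] i
  by (auto simp: char_fun_eq_iff interior_rel_def interior_operators_def)

lemma transfer_system_Inter:
  assumes "\<And>R. R \<in> \<R> \<Longrightarrow> transfer_system R" "\<R> \<noteq> {}"
  shows "transfer_system (\<Inter>\<R>)"
  unfolding transfer_system_def
proof (intro conjI allI impI)
  show "refl (\<Inter>\<R>)" "trans (\<Inter>\<R>)"
    using transfer_systemD(2,3)[OF assms(1)] by (auto intro!: refl_onI transI)
  show "x \<le> y" if "(x, y) \<in> \<Inter>\<R>" for x y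
    using transfer_systemD(1)[OF assms(1)] that assms(2) by blast
  show "(inf x w, w) \<in> \<Inter>\<R>" if "(x, z) \<in> \<Inter>\<R>" "w \<le> z" for x z w
    using transfer_systemD(4)[OF assms(1)] that by blast
qed

text \<open>The endpoints are \<open>B\<close>, with right class \<open>interior_rel i\<close>, and \<open>A\<close>, with right class the
  intersection of all right classes in the fiber. Everything between them lies in the fiber because
  \<open>\<chi>\<close> is antitone and takes the value \<open>i\<close> at both ends.\<close>

theorem fiber_char_fun_interval:
  fixes i :: "'a::{finite, bounded_lattice} \<Rightarrow> 'a"
  assumes i: "i \<in> interior_operators"
  shows "is_fac_interval (fiber char_fun i)"
proof -
  define B where "B = (left_perp (interior_rel i), interior_rel i)"
  define RA where "RA = \<Inter> (snd ` fiber char_fun i)"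
  define A where "A = (left_perp RA, RA)"
  have B: "B \<in> Fac" "char_fun B = i"
    unfolding B_def
    using transfer_system_Fac[OF transfer_system_interior_rel[OF i]] char_fun_interior_rel[OF i]
    by auto
  then have B_fiber: "B \<in> fiber char_fun i"
    by (simp add: fiber_def)
  have "transfer_system RA"
    unfolding RA_def
  proof (rule transfer_system_Inter)
    show "transfer_system R" if "R \<in> snd ` fiber char_fun i" for R
      using that by (auto simp: fiber_def Fac_iff_transfer)
    show "snd ` fiber char_fun i \<noteq> {}"
      using B_fiber by blast
  qed
  then have A: "A \<in> Fac"
    unfolding A_def by (rule transfer_system_Fac)
  have "(i x, x) \<in> RA" for x
    using char_fun_factors unfolding RA_def fiber_def by blast
  moreover have "i x \<le> w" if "(w, x) \<in> RA" for x w
  proof -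
    have "(w, x) \<in> snd B"
      using that B_fiber unfolding RA_def by blast
    then show ?thesis
      using char_fun_least[OF B(1)] by (simp add: B(2))
  qed
  ultimately have "char_fun A x = i x" for x
    by (simp add: char_fun_eq_iff[OF A]) (simp add: A_def)
  have A_le: "fac_le A F" and le_B: "fac_le F B" if F: "F \<in> fiber char_fun i" for F
  proof -
    show "fac_le A F"
      using F by (auto simp: fac_le_def A_def RA_def)
    have "F \<in> Fac" "char_fun F = i"
      using F by (auto simp: fiber_def)
    then have R: "transfer_system (snd F)"
      by (simp add: Fac_iff_transfer)
    have "x \<le> y" "i y \<le> x" if "(x, y) \<in> snd F" for x y
      using transfer_systemD(1)[OF R that] char_fun_least[OF \<open>F \<in> Fac\<close> that]
      by (simp_all add: \<open>char_fun F = i\<close>)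
    then show "fac_le F B"
      by (auto simp: fac_le_def B_def interior_rel_def)
  qed
  have "char_fun F = i" if F: "F \<in> Fac" and "fac_le A F" "fac_le F B" for F
  proof
    fix x
    have "char_fun F x \<le> i x" "i x \<le> char_fun F x"
      using char_fun_antitone[OF A F] char_fun_antitone[OF F B(1)] that(2,3)
        \<open>char_fun A x = i x\<close> B(2) by metis+
    then show "char_fun F x = i x"
      by (rule order_antisym)
  qed
  then have "fiber char_fun i = {F \<in> Fac. fac_le A F \<and> fac_le F B}"
    using A_le le_B unfolding fiber_def by blast
  then show ?thesis
    using A B(1) unfolding is_fac_interval_def by blast
qed

lemma char_fun_image:
  "char_fun ` Fac = (interior_operators :: ('a::{finite, bounded_lattice} \<Rightarrow> 'a) set)"
proof
  show "char_fun ` Fac \<subseteq> (interior_operators :: ('a \<Rightarrow> 'a) set)"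
    using char_fun_interior by blast
  show "(interior_operators :: ('a \<Rightarrow> 'a) set) \<subseteq> char_fun ` Fac"
  proof
    fix i :: "'a \<Rightarrow> 'a" assume i: "i \<in> interior_operators"
    show "i \<in> char_fun ` Fac"
      using transfer_system_Fac[OF transfer_system_interior_rel[OF i]]
      by (rule image_eqI[rotated]) (simp add: char_fun_interior_rel[OF i])
  qed
qed

section \<open>Extremal elements of fibers\<close>

lemma interval_extremal_singleton:
  assumes "is_fac_interval S" "S \<noteq> {}"
  shows "\<exists>B\<in>S. maximal_elements S = {B}" and "\<exists>A\<in>S. minimal_elements S = {A}"
proof -
  obtain A B where A: "A \<in> Fac" and B: "B \<in> Fac"
    and S: "S = {F \<in> Fac. fac_le A F \<and> fac_le F B}"
    using assms(1) unfolding is_fac_interval_def by blast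
  have "A \<in> S" "B \<in> S"
    using assms(2) A B by (auto simp: S fac_le_def)
  have S_Fac: "F \<in> Fac" "fac_le A F" "fac_le F B" if "F \<in> S" for F
    using that by (auto simp: S)
  have "maximal_elements S = {B}"
  proof -
    have "G = B" if "G \<in> S" "fac_le B G" for G
      using that fac_le_antisym[of G B] S_Fac B by blast
    then show ?thesis
      unfolding maximal_elements_def using \<open>B \<in> S\<close> S_Fac(3) by fast
  qed
  moreover have "minimal_elements S = {A}"
  proof -
    have "G = A" if "G \<in> S" "fac_le G A" for G
      using that fac_le_antisym[of G A] S_Fac A by blast
    then show ?thesis
      unfolding minimal_elements_def using \<open>A \<in> S\<close> S_Fac(2) by fast
  qed
  ultimately show "\<exists>B\<in>S. maximal_elements S = {B}" and "\<exists>A\<in>S. minimal_elements S = {A}"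
    using \<open>A \<in> S\<close> \<open>B \<in> S\<close> by blast+
qed

text \<open>Here \<open>E\<close> stands for \<open>maximal_elements\<close> or \<open>minimal_elements\<close>; any rule that picks exactly one
  point of each nonempty fiber has a bijective restriction of \<open>\<phi>\<close>.\<close>

lemma bij_betw_fiber_representatives:
  assumes one: "\<And>f. f \<in> \<phi> ` Fac \<Longrightarrow> \<exists>F\<in>fiber \<phi> f. E (fiber \<phi> f) = {F}"
    and sub: "\<And>S. E S \<subseteq> S"
  shows "bij_betw \<phi> (\<Union>f. E (fiber \<phi> f)) (\<phi> ` Fac)"
  unfolding bij_betw_def
proof (intro conjI inj_onI equalityI subsetI)
  have mem: "F \<in> Fac" "\<phi> F = f" if "F \<in> E (fiber \<phi> f)" for F f
    using that sub[of "fiber \<phi> f"] by (auto simp: fiber_def)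
  fix F G assume FG: "F \<in> (\<Union>f. E (fiber \<phi> f))" "G \<in> (\<Union>f. E (fiber \<phi> f))" "\<phi> F = \<phi> G"
  then have "F \<in> E (fiber \<phi> (\<phi> F))" "G \<in> E (fiber \<phi> (\<phi> F))" "F \<in> Fac"
    using mem by (blast, metis UN_E mem(2), blast)
  then show "F = G"
    using one[of "\<phi> F"] by auto
next
  fix f assume "f \<in> \<phi> ` (\<Union>f. E (fiber \<phi> f))"
  then show "f \<in> \<phi> ` Fac"
    using sub unfolding fiber_def by blast
next
  fix f assume "f \<in> \<phi> ` Fac"
  then obtain F where "F \<in> fiber \<phi> f" "F \<in> E (fiber \<phi> f)"
    using one by blast
  then show "f \<in> \<phi> ` (\<Union>f. E (fiber \<phi> f))"
    by (auto simp: fiber_def)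
qed

lemma bij_betw_extremal_elements:
  assumes "\<And>f. f \<in> \<phi> ` Fac \<Longrightarrow> is_fac_interval (fiber \<phi> f)"
  shows "bij_betw \<phi> (\<Union>f. maximal_elements (fiber \<phi> f)) (\<phi> ` Fac)"
    and "bij_betw \<phi> (\<Union>f. minimal_elements (fiber \<phi> f)) (\<phi> ` Fac)"
proof -
  have nonempty: "fiber \<phi> f \<noteq> {}" if "f \<in> \<phi> ` Fac" for f
    using that unfolding fiber_def by blast
  show "bij_betw \<phi> (\<Union>f. maximal_elements (fiber \<phi> f)) (\<phi> ` Fac)"
    by (rule bij_betw_fiber_representatives[where E = maximal_elements])
      (intro interval_extremal_singleton(1) assms nonempty, assumption, assumption,
        auto simp: maximal_elements_def)
  show "bij_betw \<phi> (\<Union>f. minimal_elements (fiber \<phi> f)) (\<phi> ` Fac)"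
    by (rule bij_betw_fiber_representatives[where E = minimal_elements])
      (intro interval_extremal_singleton(2) assms nonempty, assumption, assumption,
        auto simp: minimal_elements_def)
qed

section \<open>Duality\<close>

text \<open>Transport to the dual lattice: a morphism \<open>x \<le> y\<close> becomes \<open>dual y \<le> dual x\<close>, and a
  factorization system has its two classes exchanged.\<close>

definition op_rel :: "'a rel \<Rightarrow> 'a dual rel" where
  "op_rel M = {(x, y). (undual y, undual x) \<in> M}"

definition op_fac :: "'a rel \<times> 'a rel \<Rightarrow> 'a dual rel \<times> 'a dual rel" where
  "op_fac F = (op_rel (snd F), op_rel (fst F))"

definition op_fun :: "('a \<Rightarrow> 'a) \<Rightarrow> 'a dual \<Rightarrow> 'a dual" where
  "op_fun f = dual \<circ> f \<circ> undual"

lemma dual_op_rel_iff [simp]: "(dual x, dual y) \<in> op_rel M \<longleftrightarrow> (y, x) \<in> M"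
  by (simp add: op_rel_def)

lemma all_dual_iff: "(\<forall>x. P x) \<longleftrightarrow> (\<forall>x. P (dual x))"
  by (metis dual_undual)

lemma ex_dual_iff: "(\<exists>x. P x) \<longleftrightarrow> (\<exists>x. P (dual x))"
  by (metis dual_undual)

lemma op_rel_subset_iff: "op_rel M \<subseteq> op_rel N \<longleftrightarrow> M \<subseteq> N"
  unfolding subset_iff split_paired_All all_dual_iff[where 'a = 'a] by auto

lemma op_rel_eq_iff: "op_rel M = op_rel N \<longleftrightarrow> M = N"
  by (simp add: set_eq_subset op_rel_subset_iff)

lemma op_rel_perp:
  "left_perp (op_rel M) = op_rel (right_perp M)"
  "right_perp (op_rel M) = op_rel (left_perp M)"
  unfolding set_eq_iff split_paired_All left_perp_iff right_perp_iff
    all_dual_iff[where 'a = 'a]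
  by (auto simp: left_perp_iff right_perp_iff)

lemma op_fac_Fac_iff: "op_fac F \<in> Fac \<longleftrightarrow> F \<in> Fac" for F :: "'a::order rel \<times> 'a rel"
proof -
  have Fac_iff: "F \<in> Fac \<longleftrightarrow>
      (\<forall>x z. x \<le> z \<longrightarrow> (\<exists>y. (x, y) \<in> fst F \<and> (y, z) \<in> snd F)) \<and>
      fst F = left_perp (snd F) \<and> snd F = right_perp (fst F)" for F :: "'b::order rel \<times> 'b rel"
    by (cases F) (simp add: Fac_def)
  show ?thesis
    unfolding Fac_iff op_fac_def all_dual_iff[where 'a = 'a] ex_dual_iff[where 'a = 'a]
    by (simp add: op_rel_perp op_rel_eq_iff) blast
qed

lemma op_fac_surj: "\<exists>F. G = op_fac F"
proof
  let ?back = "\<lambda>M. {(x, y). (dual y, dual x) \<in> M}"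
  show "G = op_fac (?back (snd G), ?back (fst G))"
    by (simp add: op_fac_def op_rel_def)
qed

text \<open>Inclusion of the right classes of the dual systems is inclusion of the left classes of the
  original ones, which is opposite to inclusion of the right classes.\<close>

lemma fac_le_op_fac_iff:
  assumes "F \<in> Fac" "G \<in> Fac"
  shows "fac_le (op_fac F) (op_fac G) \<longleftrightarrow> fac_le G F"
proof -
  have F: "fst F = left_perp (snd F)" "snd F = right_perp (fst F)"
    and G: "fst G = left_perp (snd G)" "snd G = right_perp (fst G)"
    using assms by (auto simp: Fac_def)
  have "snd G \<subseteq> snd F" if "fst F \<subseteq> fst G"
    unfolding F(2) G(2) using that by (auto simp: right_perp_def)
  moreover have "fst F \<subseteq> fst G" if "snd G \<subseteq> snd F"
    unfolding F(1) G(1) using that by (auto simp: left_perp_def)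
  ultimately show ?thesis
    by (auto simp: fac_le_def op_fac_def op_rel_subset_iff)
qed

lemma op_fun_eq_iff: "op_fun f = op_fun g \<longleftrightarrow> f = g"
  by (auto simp: op_fun_def fun_eq_iff all_dual_iff[where 'a = 'a])

lemma op_fun_interior_iff: "op_fun c \<in> interior_operators \<longleftrightarrow> c \<in> closure_operators"
  by (auto simp: op_fun_def interior_operators_def closure_operators_def mono_def
      all_dual_iff[where 'a = 'a])

lemma char_fun_op_fac:
  fixes F :: "'a::bounded_lattice rel \<times> 'a rel"
  assumes "F \<in> Fac"
  shows "char_fun (op_fac F) = op_fun (cochar_fun F)"
proof
  fix x :: "'a dual"
  let ?y = "char_fun (op_fac F) x"
  have Fac: "op_fac F \<in> Fac"
    using assms by (simp add: op_fac_Fac_iff)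
  have y: "(undual x, undual ?y) \<in> fst F" "(undual ?y, top) \<in> snd F"
    using char_fun_factors[OF Fac, of x] by (auto simp: op_fac_def op_rel_def)
  have "cochar_fun F (undual x) = undual ?y"
    unfolding cochar_fun_def case_prod_unfold
  proof (rule the_equality)
    fix z assume "(undual x, z) \<in> fst F \<and> (z, top) \<in> snd F"
    with y show "z = undual ?y"
      using assms by (auto simp: Fac_def left_perp_iff intro!: order_antisym)
  qed (use y in blast)
  then show "?y = op_fun (cochar_fun F) x"
    by (simp add: op_fun_def)
qed

lemma op_fac_coreflective_reflective:
  fixes F :: "'a::bounded_lattice rel \<times> 'a rel"
  assumes "coreflective (op_fac F)"
  shows "reflective F"
proof -
  obtain r where r: "mono r" "range r \<subseteq> {x. (bot, x) \<in> fst (op_fac F)}"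
    "\<And>x s. (bot, s) \<in> fst (op_fac F) \<Longrightarrow> s \<le> r x \<longleftrightarrow> s \<le> x"
    using assms unfolding coreflective_def coreflective_subset_def by blast
  have fst_op: "(bot, s) \<in> fst (op_fac F) \<longleftrightarrow> (undual s, top) \<in> snd F" for s
    by (simp add: op_fac_def op_rel_def)
  let ?r = "undual \<circ> r \<circ> dual"
  have "mono ?r"
    using r(1) by (auto simp: mono_def dual_less_eq_iff)
  moreover have "range ?r \<subseteq> {x. (x, top) \<in> snd F}"
    using r(2) by (auto simp: fst_op)
  moreover have "?r x \<le> s \<longleftrightarrow> x \<le> s" if "(s, top) \<in> snd F" for x s
    using r(3)[of "dual s" "dual x"] that by (simp add: fst_op dual_less_eq_iff)
  ultimately have "reflective_subset {x. (x, top) \<in> snd F}"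
    unfolding reflective_subset_def by (intro exI[of _ ?r]) simp
  then show ?thesis
    using assms by (simp add: reflective_def coreflective_def op_fac_Fac_iff)
qed

lemma Fac_reflective:
  "F \<in> Fac \<Longrightarrow> reflective F" for F :: "'a::{finite, bounded_lattice} rel \<times> 'a rel"
  by (simp add: op_fac_coreflective_reflective Fac_coreflective op_fac_Fac_iff)

lemma fiber_cochar_fun_iff:
  "F \<in> fiber cochar_fun c \<longleftrightarrow> op_fac F \<in> fiber char_fun (op_fun c)"
  for F :: "'a::bounded_lattice rel \<times> 'a rel"
  by (auto simp: fiber_def op_fac_Fac_iff char_fun_op_fac op_fun_eq_iff)

lemma cochar_fun_image:
  "cochar_fun ` Fac = (closure_operators :: ('a::{finite, bounded_lattice} \<Rightarrow> 'a) set)"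
proof -
  have "c \<in> cochar_fun ` Fac \<longleftrightarrow> op_fun c \<in> char_fun ` Fac" for c :: "'a \<Rightarrow> 'a"
  proof -
    have "c \<in> cochar_fun ` Fac \<longleftrightarrow> (\<exists>F. F \<in> fiber cochar_fun c)"
      unfolding fiber_def by blast
    also have "\<dots> \<longleftrightarrow> (\<exists>G. G \<in> fiber char_fun (op_fun c))"
      unfolding fiber_cochar_fun_iff using op_fac_surj by metis
    also have "\<dots> \<longleftrightarrow> op_fun c \<in> char_fun ` Fac"
      by (simp add: fiber_def image_iff Bex_def eq_commute)
    finally show ?thesis .
  qed
  then show ?thesis
    unfolding set_eq_iff by (simp add: char_fun_image op_fun_interior_iff)
qed

lemma fiber_cochar_fun_interval:
  fixes c :: "'a::{finite, bounded_lattice} \<Rightarrow> 'a"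
  assumes "c \<in> closure_operators"
  shows "is_fac_interval (fiber cochar_fun c)"
proof -
  have "is_fac_interval (fiber char_fun (op_fun c))"
    using assms by (simp add: fiber_char_fun_interval op_fun_interior_iff)
  then obtain A B where "A \<in> Fac" "B \<in> Fac"
    and fiber: "fiber char_fun (op_fun c) = {F \<in> Fac. fac_le A F \<and> fac_le F B}"
    unfolding is_fac_interval_def by blast
  moreover obtain A' B' where "A = op_fac A'" "B = op_fac B'"
    using op_fac_surj by blast
  ultimately have A': "A' \<in> Fac" and B': "B' \<in> Fac"
    and "fiber cochar_fun c = {F \<in> Fac. fac_le B' F \<and> fac_le F A'}"
    by (auto simp: fiber_cochar_fun_iff op_fac_Fac_iff fac_le_op_fac_iff)
  then show ?thesis
    unfolding is_fac_interval_def by blast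
qed

section \<open>Interior and closure operators as extremal factorization systems\<close>

theorem theorem3p9:
  shows "((char_fun ` Fac :: ('a::{finite, bounded_lattice} \<Rightarrow> 'a) set) = interior_operators \<and>
          (\<forall>f \<in> char_fun ` (Fac :: ('a rel \<times> 'a rel) set). is_fac_interval (fiber char_fun f)) \<and>
          (\<Union>f :: 'a \<Rightarrow> 'a. maximal_elements (fiber char_fun f)) \<subseteq> {F. coreflective F} \<and>
          bij_betw char_fun
            {F. coreflective F \<and> F \<in> (\<Union>f :: 'a \<Rightarrow> 'a. maximal_elements (fiber char_fun f))}
            interior_operators) \<and>
         ((cochar_fun ` Fac :: ('a \<Rightarrow> 'a) set) = closure_operators \<and>
          (\<forall>f \<in> cochar_fun ` (Fac :: ('a rel \<times> 'a rel) set). is_fac_interval (fiber cochar_fun f)) \<and>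
          (\<Union>f :: 'a \<Rightarrow> 'a. minimal_elements (fiber cochar_fun f)) \<subseteq> {F. reflective F} \<and>
          bij_betw cochar_fun
            {F. reflective F \<and> F \<in> (\<Union>f :: 'a \<Rightarrow> 'a. minimal_elements (fiber cochar_fun f))}
            closure_operators)"
proof -
  have max: "(\<Union>f :: 'a \<Rightarrow> 'a. maximal_elements (fiber char_fun f)) \<subseteq> {F. coreflective F}"
    using Fac_coreflective by (fastforce simp: maximal_elements_def fiber_def)
  have min: "(\<Union>f :: 'a \<Rightarrow> 'a. minimal_elements (fiber cochar_fun f)) \<subseteq> {F. reflective F}"
    using Fac_reflective by (fastforce simp: minimal_elements_def fiber_def)
  have max_eq: "{F. coreflective F \<and> F \<in> (\<Union>f :: 'a \<Rightarrow> 'a. maximal_elements (fiber char_fun f))} =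
      (\<Union>f. maximal_elements (fiber char_fun f))"
    using max by blast
  have min_eq: "{F. reflective F \<and> F \<in> (\<Union>f :: 'a \<Rightarrow> 'a. minimal_elements (fiber cochar_fun f))} =
      (\<Union>f. minimal_elements (fiber cochar_fun f))"
    using min by blast
  have "bij_betw char_fun (\<Union>f :: 'a \<Rightarrow> 'a. maximal_elements (fiber char_fun f)) interior_operators"
    unfolding char_fun_image[symmetric]
    by (rule bij_betw_extremal_elements(1)) (simp add: char_fun_image fiber_char_fun_interval)
  moreover have "bij_betw cochar_fun (\<Union>f :: 'a \<Rightarrow> 'a. minimal_elements (fiber cochar_fun f))
      closure_operators"
    unfolding cochar_fun_image[symmetric]
    by (rule bij_betw_extremal_elements(2)) (simp add: cochar_fun_image fiber_cochar_fun_interval)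
  ultimately show ?thesis
    unfolding max_eq min_eq char_fun_image cochar_fun_image
    using max min fiber_char_fun_interval fiber_cochar_fun_interval by blast
qed

end
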